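(* Let $G$ be a complete multipartite graph. Then $G$ is non-trivially minimally tough if and only if $G$ is isomorphic to one of the graphs $K_{2,3}$, $K_{1,\ell}$, $T_{2\ell,\ell}$, or $T_{2\ell-1,\ell}$, for some integer $\ell \geq 2$.
   Context: All graphs are finite, simple, and undirected. For a graph $H$, $c(H)$ denotes the number of connected components of $H$. A set $S\subseteq V(G)$ is a separator of $G$ if $c(G-S)\ge 2$. The toughness $\tau(G)$ of a graph $G$ is the minimum of $|S|/c(G-S)$ over all separators $S$ of $G$, with $\tau(G)=\infty$ if $G$ has no separators, that is, if $G$ is complete. (Disconnected graphs have toughness $0$.) For $t\in\mathbb{R}\cup\{\infty\}$, $G$ is minimally $t$-tough if $\tau(G)=t$ and $\tau(G-e)<t$ for every edge $e$ of $G$ ($G-e$ is obtained by deleting the edge $e$). $G$ is minimally tough if it is minimally $t$-tough for some $t\in\mathbb{R}\cup\{\infty\}$. Complete graphs and edgeless graphs are trivially minimally tough; all other minimally tough graphs are called non-trivially minimally tough. $K_{m,n}$ is the complete bipartite graph with parts of sizes $m$ and $n$. A complete multipartite graph is one whose vertex set can be partitioned into (nonempty) parts such that two distinct vertices are adjacent iff they belong to different parts. $T_{n,k}$ denotes the complete multipartite graph with $n$ vertices and $k$ parts whose sizes are as equal as possible; thus all parts of $T_{2\ell,\ell}$ have size $2$, and all parts of $T_{2\ell-1,\ell}$ have size $2$ except one of size $1$. *)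

theory Defs
  imports
    "Graph_Theory.Graph_Theory"
    "HOL-Library.Extended_Real"
    "HOL-Library.Disjoint_Sets"
begin

text \<open>
  A finite simple undirected graph is a \<^locale>\<open>pair_graph\<close>: an edge \<open>uv\<close> is represented by the
  two arcs \<open>(u, v)\<close> and \<open>(v, u)\<close>. The graph without vertices is allowed; it counts both as
  complete and as edgeless.
\<close>

definition del_verts :: "'a pair_pre_digraph \<Rightarrow> 'a set \<Rightarrow> ('a, 'a \<times> 'a) pre_digraph" where
  "del_verts G S = with_proj G \<restriction> (pverts G - S)"

definition del_edge :: "'a pair_pre_digraph \<Rightarrow> 'a \<Rightarrow> 'a \<Rightarrow> 'a pair_pre_digraph" where
  "del_edge G u v = \<lparr>pverts = pverts G, parcs = parcs G - {(u, v), (v, u)}\<rparr>"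

text \<open>The predicate \<^const>\<open>connected\<close> is false for the graph without vertices.\<close>

definition num_components :: "('a, 'b) pre_digraph \<Rightarrow> nat" where
  "num_components H = card {C. pre_digraph.max_subgraph H connected C}"

definition separators :: "'a pair_pre_digraph \<Rightarrow> 'a set set" where
  "separators G = {S. S \<subseteq> pverts G \<and> num_components (del_verts G S) \<ge> 2}"

definition toughness :: "'a pair_pre_digraph \<Rightarrow> ereal" where
  "toughness G =
    (if separators G = {} then \<infinity>
     else ereal (Min ((\<lambda>S. real (card S) / real (num_components (del_verts G S))) ` separators G)))"

definition minimally_t_tough :: "ereal \<Rightarrow> 'a pair_pre_digraph \<Rightarrow> bool" where
  "minimally_t_tough t G \<longleftrightarrow>
    toughness G = t \<and> (\<forall>(u, v) \<in> parcs G. toughness (del_edge G u v) < t)"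

definition minimally_tough :: "'a pair_pre_digraph \<Rightarrow> bool" where
  "minimally_tough G \<longleftrightarrow> (\<exists>t \<in> range ereal \<union> {\<infinity>}. minimally_t_tough t G)"

definition nontrivially_minimally_tough :: "'a pair_pre_digraph \<Rightarrow> bool" where
  "nontrivially_minimally_tough G \<longleftrightarrow>
    minimally_tough G \<and> \<not> (\<exists>n. complete_digraph n (with_proj G)) \<and> parcs G \<noteq> {}"

definition complete_multipartite_with :: "'a pair_pre_digraph \<Rightarrow> 'a set set \<Rightarrow> bool" where
  "complete_multipartite_with G P \<longleftrightarrow>
    pair_graph G \<and> partition_on (pverts G) P \<and>
    (\<forall>u \<in> pverts G. \<forall>v \<in> pverts G. u \<noteq> v \<longrightarrow>
      ((u, v) \<in> parcs G \<longleftrightarrow> (\<exists>A \<in> P. \<exists>B \<in> P. A \<noteq> B \<and> u \<in> A \<and> v \<in> B)))"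

definition complete_multipartite :: "'a pair_pre_digraph \<Rightarrow> bool" where
  "complete_multipartite G \<longleftrightarrow> (\<exists>P. complete_multipartite_with G P)"

text \<open>
  Like the library's \<^const>\<open>complete_digraph\<close> and \<^const>\<open>complete_bipartite_digraph\<close>, the graph
  \<open>T\<^bsub>n,k\<^esub>\<close> is described by a predicate that determines it up to isomorphism. ``As equal as
  possible'' means that any two part sizes differ by at most one.
\<close>

definition turan :: "nat \<Rightarrow> nat \<Rightarrow> 'a pair_pre_digraph \<Rightarrow> bool" where
  "turan n k G \<longleftrightarrow>
    (\<exists>P. complete_multipartite_with G P \<and> card (pverts G) = n \<and> card P = k \<and>
      (\<forall>A \<in> P. \<forall>B \<in> P. card A \<le> card B + 1))"

end

theory Submission
  imports Defs
begin

text \<open>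
  Let \<open>G\<close> be complete multipartite with \<open>n\<close> vertices, and suppose that it is neither complete nor
  edgeless; let \<open>m \<ge> 2\<close> be the size of a largest part.

  As soon as vertices of two different parts remain, \<open>G - S\<close> is connected. So the separators of \<open>G\<close> are
  the sets whose complement consists of at least two vertices of one part, these vertices being the
  components, and the best separator keeps a whole largest part: the toughness is \<open>(n - m)/m\<close>
  (\<open>toughness_eq\<close>).

  Deleting an edge \<open>uv\<close> with \<open>u \<in> A\<close> and \<open>v \<in> B\<close> creates few new separators. What remains must be
  contained in \<open>{u} \<union> B\<close> or in \<open>{v} \<union> A\<close>, and there are always two components, one of them a single end
  of the edge (\<open>separator_after_del_edge\<close>, \<open>cut_after_del_edge\<close>). With \<open>x\<close> the larger of the sizes of \<open>A\<close>
  and \<open>B\<close>, the smallest new ratio is \<open>(n - x - 1)/2\<close>. Hence \<open>G\<close> is minimally tough if and only if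
  \<open>(n - x - 1)/2 < (n - m)/m\<close>, that is \<open>m n + m < 2 n + m x\<close>, for every pair of distinct parts
  (\<open>nontrivially_minimally_tough_iff\<close>).

  The rest is a case analysis on part sizes (\<open>nontrivially_minimally_tough_iff_parts\<close>). For \<open>m = 2\<close> the
  condition reads \<open>x > 1\<close>, so at most one part is a singleton, which gives \<open>T\<^bsub>2l,l\<^esub>\<close> and \<open>T\<^bsub>2l-1,l\<^esub>\<close>. For
  \<open>m \<ge> 3\<close>, applying it to two parts other than a largest one leads to a contradiction, so there are
  only two parts, and it becomes \<open>(m - 2) c < m\<close> for the size \<open>c\<close> of the other part: \<open>c = 1\<close>, or
  \<open>c = 2\<close> and \<open>m = 3\<close>.
\<close>

section \<open>Connected components\<close>

lemma strongly_connected_imp_connected: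
  assumes "wf_digraph H" "strongly_connected H"
  shows "connected H"
proof -
  have "(arcs_ends H) \<subseteq> (arcs_ends H)\<^sup>s" by (auto simp: symcl_def)
  then show ?thesis
    using assms(2) unfolding connected_conv strongly_connected_def reachable_def
    by (meson rtrancl_on_mono subset_refl)
qed

text \<open>
  Components are counted as maximal connected subgraphs, which need not be induced a priori. Adding
  arcs between the same vertices preserves connectedness, so a maximal one is induced; as an induced
  subgraph of a symmetric digraph it is symmetric itself, and there weak and strong connectedness
  coincide. This gives access to the theory of strongly connected components.
\<close>

lemma (in sym_digraph) max_subgraph_connected_iff_sccs:
  "max_subgraph connected C \<longleftrightarrow> C \<in> sccs"
proof
  assume C: "max_subgraph connected C"
  have "arc_mono connected"
    unfolding arc_mono_def
    by (metis spanning_def subgraphE wf_digraph.connected_spanning_imp_connected)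
  with C have "induced_subgraph C G" by (rule induced_subgraphI_arc_mono)
  then have "sym_digraph C" by (rule induced_graph_imp_graph)
  then have "strongly_connected C"
    using C by (meson max_subgraph_prop sym_digraph.axioms(1) sym_digraph.sym_arcs
        wf_digraph.symmetric_connected_imp_strongly_connected)
  moreover have "strongly_connected H \<Longrightarrow> connected H" if "wf_digraph H" for H :: "('a, 'b) pre_digraph"
    using that by (rule strongly_connected_imp_connected)
  ultimately show "C \<in> sccs"
    using C unfolding sccs_altdef2 max_subgraph_def
    by (auto simp: subgraph_def)
next
  assume "C \<in> sccs"
  then have C: "max_subgraph strongly_connected C" by (simp add: sccs_altdef2)
  show "max_subgraph connected C"
  proof (rule max_subgraphI)
    show "subgraph C G" and "connected C"
      using C by (auto simp: max_subgraph_def subgraph_def intro: strongly_connected_imp_connected)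
    fix D assume D: "C \<noteq> D" "subgraph C D" "subgraph D G"
    show "\<not> connected D"
    proof
      assume conn: "connected D"
      let ?I = "G \<restriction> verts D"
      have DI: "subgraph D ?I" "subgraph ?I G"
        using D(3) by (auto intro: subgraph_induce_subgraphI2 subgraph_induce_subgraphI)
      then have "spanning D ?I" by (simp add: spanning_def)
      then have "connected ?I"
        using conn DI(1) by (meson subgraphE wf_digraph.connected_spanning_imp_connected)
      moreover have "sym_digraph ?I"
        using D(3) by (intro induced_graph_imp_graph) auto
      ultimately have "strongly_connected ?I"
        by (meson sym_digraph.axioms(1) sym_digraph.sym_arcs
            wf_digraph.symmetric_connected_imp_strongly_connected)
      moreover have "subgraph C ?I" using D(2) DI(1) by (rule subgraph_trans)
      ultimately have "C = ?I"
        using C DI(2) by (auto simp: max_subgraph_def)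
      then have "subgraph D C" using DI(1) by simp
      with D(2) have "C = D"
        by (intro pre_digraph.equality) (auto simp: subgraph_def compatible_tail compatible_head)
      with D(1) show False ..
    qed
  qed
qed

lemma (in sym_digraph) num_components_eq_card_sccs_verts:
  "num_components G = card sccs_verts"
  by (simp add: num_components_def max_subgraph_connected_iff_sccs card_sccs_verts)

text \<open>
  A partition into internally connected blocks without arcs between different blocks must be the
  partition into components. To certify that a block is connected it suffices to name one vertex
  that all others reach, since reachability is symmetric.
\<close>

lemma (in sym_digraph) sccs_verts_eq_partition:
  assumes part: "partition_on (verts G) Q"
    and conn: "\<And>B. B \<in> Q \<Longrightarrow> \<exists>w. \<forall>x \<in> B. x \<rightarrow>\<^sup>* w"
    and sep: "\<And>x y B. B \<in> Q \<Longrightarrow> x \<in> B \<Longrightarrow> x \<rightarrow>\<^bsub>G\<^esub> y \<Longrightarrow> y \<in> B"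
  shows "sccs_verts = Q"
proof -
  have reach_in: "y \<in> B" if "x \<rightarrow>\<^sup>* y" "B \<in> Q" "x \<in> B" for x y B
    using that by (induct rule: reachable_induct) (auto intro: sep)
  have scc: "scc_of x = B" if "B \<in> Q" "x \<in> B" for x B
  proof -
    obtain w where w: "\<And>y. y \<in> B \<Longrightarrow> y \<rightarrow>\<^sup>* w" using conn[OF \<open>B \<in> Q\<close>] by blast
    have "x \<rightarrow>\<^sup>* y" "y \<rightarrow>\<^sup>* x" if "y \<in> B" for y
      using w[OF \<open>x \<in> B\<close>] w[OF that] by (blast intro: reachable_trans symmetric_reachable')+
    then show ?thesis
      using reach_in[OF _ that] unfolding scc_of_def by blast
  qed
  have "B \<in> scc_of ` \<Union> Q" if B: "B \<in> Q" for B
  proof -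
    have "B \<noteq> {}" using partition_onD3[OF part] B by metis
    then obtain x where "x \<in> B" by blast
    then show ?thesis using scc[OF B] B by blast
  qed
  then show ?thesis
    unfolding sccs_verts_conv_scc_of partition_onD1[OF part]
    using scc by (force simp: image_iff)
qed

text \<open>
  All component counts below come from this lemma. Connectedness of a block is asked for inside the
  block, in terms of the arcs of \<open>H\<close>, so that its use requires no reasoning about induced subgraphs.
\<close>

lemma num_components_del_verts:
  assumes "pair_graph H"
    and part: "partition_on (pverts H - S) Q"
    and conn: "\<And>B. B \<in> Q \<Longrightarrow> \<exists>w. \<forall>x \<in> B. (x, w) \<in> (parcs H \<inter> B \<times> B)\<^sup>*"
    and sep: "\<And>x y B. B \<in> Q \<Longrightarrow> x \<in> B \<Longrightarrow> (x, y) \<in> parcs H \<Longrightarrow> y \<notin> S \<Longrightarrow> y \<in> B"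
  shows "num_components (del_verts H S) = card Q"
proof -
  interpret H: pair_graph H by fact
  let ?I = "del_verts H S"
  have I: "verts ?I = pverts H - S" "arcs_ends ?I = parcs H \<inter> (pverts H - S) \<times> (pverts H - S)"
    by (auto simp: del_verts_def induce_subgraph_def arcs_ends_conv image_iff) 
  have "induced_subgraph ?I (with_proj H)"
    unfolding del_verts_def by (rule H.induced_induce) auto
  then interpret I: sym_digraph ?I
    by (rule H.induced_graph_imp_graph)
  have "I.sccs_verts = Q"
  proof (rule I.sccs_verts_eq_partition)
    show "partition_on (verts ?I) Q" using part by (simp add: I)
    fix B assume B: "B \<in> Q"
    then have BV: "B \<subseteq> pverts H - S" using partition_onD1[OF part] by auto
    then have "(parcs H \<inter> B \<times> B)\<^sup>* \<subseteq> (arcs_ends ?I)\<^sup>*"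
      by (intro rtrancl_mono) (auto simp: I)
    with conn[OF B] obtain w where "\<forall>x \<in> B. (x, w) \<in> (arcs_ends ?I)\<^sup>*" by blast
    then show "\<exists>w. \<forall>x \<in> B. x \<rightarrow>\<^sup>*\<^bsub>?I\<^esub> w"
      using BV I(1) I.reachable_conv' by (metis subsetD)
  next
    fix x y B assume "B \<in> Q" "x \<in> B" "x \<rightarrow>\<^bsub>?I\<^esub> y"
    then show "y \<in> B" using sep by (auto simp: I)
  qed
  then show ?thesis by (simp add: I.num_components_eq_card_sccs_verts)
qed

section \<open>Toughness as a minimum over cuts\<close>

abbreviation cut_ratio :: "'a pair_pre_digraph \<Rightarrow> 'a set \<Rightarrow> real" where
  "cut_ratio H S \<equiv> real (card S) / real (num_components (del_verts H S))"

lemma finite_separators: "finite (pverts H) \<Longrightarrow> finite (separators H)"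
  by (rule finite_subset[of _ "Pow (pverts H)"]) (auto simp: separators_def)

text \<open>
  A graph without separators has toughness \<open>\<infinity>\<close>, which agrees with the empty existential. Minimal
  toughness asks for strict upper bounds on the toughness of edge-deleted graphs, and each of them is
  certified by a single separator.
\<close>

lemma toughness_less_iff:
  assumes "finite (pverts H)"
  shows "toughness H < ereal t \<longleftrightarrow> (\<exists>S \<in> separators H. cut_ratio H S < t)"
  using finite_separators[OF assms] by (auto simp: toughness_def Min_less_iff)

lemma toughness_eqI:
  assumes "finite (pverts H)" "S \<in> separators H"
    and "\<And>S'. S' \<in> separators H \<Longrightarrow> cut_ratio H S \<le> cut_ratio H S'"
  shows "toughness H = ereal (cut_ratio H S)"
proof -
  have "Min (cut_ratio H ` separators H) = cut_ratio H S"
    using assms finite_separators[of H] by (intro Min_eqI) auto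
  then show ?thesis using assms(2) by (auto simp: toughness_def)
qed

lemma num_components_independent:
  assumes "pair_graph H" "\<And>x y. x \<in> pverts H - S \<Longrightarrow> y \<in> pverts H - S \<Longrightarrow> (x, y) \<notin> parcs H"
  shows "num_components (del_verts H S) = card (pverts H - S)"
proof -
  interpret H: pair_graph H by fact
  let ?Q = "(\<lambda>x. {x}) ` (pverts H - S)"
  have "num_components (del_verts H S) = card ?Q"
  proof (rule num_components_del_verts)
    show "partition_on (pverts H - S) ?Q" by (auto simp: partition_on_def disjoint_def)
  qed (use assms H.in_arcsD2 in auto)
  also have "\<dots> = card (pverts H - S)" by (intro card_image) auto
  finally show ?thesis .
qed

lemma num_components_hub:
  assumes "pair_graph H" "w \<in> pverts H - S"
    and "\<And>x. x \<in> pverts H - S \<Longrightarrow> (x, w) \<in> (parcs H \<inter> (pverts H - S) \<times> (pverts H - S))\<^sup>*"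
  shows "num_components (del_verts H S) = 1"
proof -
  interpret H: pair_graph H by fact
  have "num_components (del_verts H S) = card {pverts H - S}"
    using assms H.in_arcsD2 by (intro num_components_del_verts) (auto intro: partition_on_space)
  then show ?thesis by simp
qed

text \<open>
  This is the shape of what remains in the only new separations that the deletion of an edge of a
  complete multipartite graph creates: a star centred at one end of the edge, and the other end
  isolated.
\<close>

lemma num_components_star_and_isolated:
  assumes "pair_graph H" and R: "pverts H - S = insert v R" "v \<notin> R"
    and isol: "\<And>x. x \<in> R \<Longrightarrow> (v, x) \<notin> parcs H"
    and star: "w \<in> R" "\<And>x. x \<in> R \<Longrightarrow> x \<noteq> w \<Longrightarrow> (x, w) \<in> parcs H"
  shows "num_components (del_verts H S) = 2"
proof -
  interpret H: pair_graph H by fact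
  have isol': "(x, v) \<notin> parcs H" if "x \<in> R" for x
    using isol[OF that] H.arcs_symmetric by blast
  have "num_components (del_verts H S) = card {{v}, R}"
  proof (rule num_components_del_verts)
    show "partition_on (pverts H - S) {{v}, R}"
      using R star(1) by (auto simp: partition_on_def disjoint_def)
  next
    fix B assume "B \<in> {{v}, R}"
    then consider "B = {v}" | "B = R" by blast
    then show "\<exists>w. \<forall>x\<in>B. (x, w) \<in> (parcs H \<inter> B \<times> B)\<^sup>*"
    proof cases
      case 2
      have "(x, w) \<in> (parcs H \<inter> R \<times> R)\<^sup>*" if "x \<in> R" for x
        using star(2)[OF that] star(1) that by (cases "x = w") auto
      with 2 show ?thesis by auto
    qed auto
  next
    fix x y B assume B: "B \<in> {{v}, R}" "x \<in> B" and xy: "(x, y) \<in> parcs H" "y \<notin> S"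
    then have "y \<in> insert v R" using H.in_arcsD2 R(1) by blast
    moreover have "x \<noteq> y" using xy(1) H.pair_no_loops by force
    ultimately show "y \<in> B" using B xy(1) isol isol' by auto
  qed fact
  also have "\<dots> = 2" using R(2) by (subst card_2_iff) auto
  finally show ?thesis .
qed

section \<open>Complete multipartite graphs\<close>

locale multipartite_graph =
  fixes G :: "'a pair_pre_digraph" and P :: "'a set set"
  assumes multipartite: "complete_multipartite_with G P"
begin

sublocale pair_graph G
  using multipartite by (simp add: complete_multipartite_with_def)

lemma part: "partition_on (pverts G) P"
  using multipartite by (simp add: complete_multipartite_with_def)

lemma part_subset: "A \<in> P \<Longrightarrow> A \<subseteq> pverts G"
  using part by (auto simp: partition_on_def)

lemma part_nonempty: "A \<in> P \<Longrightarrow> A \<noteq> {}"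
  using part by (auto simp: partition_on_def)

lemma part_finite: "A \<in> P \<Longrightarrow> finite A"
  using part_subset pair_finite_verts finite_subset by blast

lemma finite_parts: "finite P"
  using part pair_finite_verts by (rule finite_elements[rotated])

lemma part_unique: "A \<in> P \<Longrightarrow> B \<in> P \<Longrightarrow> x \<in> A \<Longrightarrow> x \<in> B \<Longrightarrow> A = B"
  using part by (auto simp: partition_on_def disjoint_def)

lemma in_part: "x \<in> pverts G \<Longrightarrow> \<exists>A \<in> P. x \<in> A"
  using part by (auto simp: partition_on_def)

lemma adjacent_iff:
  assumes "A \<in> P" "B \<in> P" "x \<in> A" "y \<in> B"
  shows "(x, y) \<in> parcs G \<longleftrightarrow> A \<noteq> B"
proof (cases "x = y")
  case True
  then show ?thesis using assms part_unique pair_no_loops by force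
next
  case False
  then have "(x, y) \<in> parcs G \<longleftrightarrow> (\<exists>A \<in> P. \<exists>B \<in> P. A \<noteq> B \<and> x \<in> A \<and> y \<in> B)"
    using assms part_subset multipartite unfolding complete_multipartite_with_def by blast
  then show ?thesis using assms part_unique by metis
qed

lemma edge_parts:
  assumes "(u, v) \<in> parcs G"
  obtains A B where "A \<in> P" "B \<in> P" "u \<in> A" "v \<in> B" "A \<noteq> B"
  using assms in_part adjacent_iff in_arcsD1 in_arcsD2 by metis

lemma num_components_in_part:
  assumes "A \<in> P" "pverts G - S \<subseteq> A"
  shows "num_components (del_verts G S) = card (pverts G - S)"
  using assms(2) adjacent_iff[OF assms(1,1)]
  by (intro num_components_independent[OF pair_graph_axioms]) blast

text \<open>
  Two remaining vertices \<open>x\<close>, \<open>y\<close> in different parts keep everything connected: a vertex outside the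
  part of \<open>y\<close> is adjacent to \<open>y\<close>, and a vertex inside it is adjacent to \<open>x\<close>.
\<close>

lemma num_components_across_parts:
  assumes "A \<in> P" "B \<in> P" "A \<noteq> B" "x \<in> A - S" "y \<in> B - S"
  shows "num_components (del_verts G S) = 1"
proof (rule num_components_hub)
  let ?R = "pverts G - S"
  let ?E = "parcs G \<inter> ?R \<times> ?R"
  show y: "y \<in> ?R" using assms part_subset by blast
  have x: "x \<in> ?R" using assms part_subset by blast
  fix z assume z: "z \<in> ?R"
  then obtain C where C: "C \<in> P" "z \<in> C" using in_part by blast
  show "(z, y) \<in> ?E\<^sup>*"
  proof (cases "C = B")
    case True
    then have "(z, x) \<in> ?E" "(x, y) \<in> ?E" using assms C x y z adjacent_iff by auto
    then show ?thesis by (meson converse_rtrancl_into_rtrancl r_into_rtrancl)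
  next
    case False
    then have "(z, y) \<in> ?E" using assms C y z adjacent_iff by auto
    then show ?thesis by blast
  qed
qed (rule pair_graph_axioms)

lemma separator_leaves_one_part:
  assumes "S \<in> separators G"
  obtains A where "A \<in> P" "pverts G - S \<subseteq> A"
proof -
  let ?R = "pverts G - S"
  have two: "num_components (del_verts G S) \<ge> 2" using assms by (simp add: separators_def)
  have "?R \<noteq> {}"
  proof
    assume "?R = {}"
    then have "num_components (del_verts G S) = card ?R"
      by (intro num_components_independent[OF pair_graph_axioms]) blast
    with two \<open>?R = {}\<close> show False by simp
  qed
  then obtain x where x: "x \<in> ?R" by blast
  then obtain A where A: "A \<in> P" "x \<in> A" using in_part by blast
  have "y \<in> A" if y: "y \<in> ?R" for y
  proof -
    obtain B where B: "B \<in> P" "y \<in> B" using in_part y by blast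
    then have "A = B"
      using num_components_across_parts[of A B x S y] A x y two by auto
    with B show ?thesis by simp
  qed
  with A(1) show ?thesis using that by blast
qed

lemma vertices_outside:
  assumes "R \<subseteq> pverts G"
  shows "card (pverts G - R) = card (pverts G) - card R" "card R \<le> card (pverts G)"
    "pverts G - (pverts G - R) = R"
  using assms pair_finite_verts finite_subset[OF assms] card_Diff_subset[of R "pverts G"]
    card_mono[of "pverts G" R] by auto

text \<open>
  A separator that leaves \<open>r\<close> vertices leaves \<open>r\<close> isolated vertices of one part, so its ratio is
  \<open>n/r - 1\<close>. This decreases in \<open>r\<close>, hence the best choice is to keep a whole largest part.
\<close>

lemma toughness_eq:
  assumes M: "M \<in> P" "\<And>A. A \<in> P \<Longrightarrow> card A \<le> card M" "card M \<ge> 2"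
  shows "toughness G = ereal ((real (card (pverts G)) - card M) / card M)"
proof -
  let ?n = "card (pverts G)" and ?S = "pverts G - M"
  have MV: "M \<subseteq> pverts G" using part_subset M(1) .
  have comp: "num_components (del_verts G ?S) = card M"
    using num_components_in_part[OF M(1), of ?S] vertices_outside(3)[OF MV] by simp
  then have sep: "?S \<in> separators G" using M(3) by (auto simp: separators_def)
  have ratio: "cut_ratio G ?S = (real ?n - card M) / card M"
    using comp vertices_outside[OF MV] by (simp add: of_nat_diff)
  have "toughness G = ereal (cut_ratio G ?S)"
  proof (rule toughness_eqI[OF pair_finite_verts sep])
    fix S assume S: "S \<in> separators G"
    then obtain A where A: "A \<in> P" "pverts G - S \<subseteq> A" by (rule separator_leaves_one_part)
    let ?r = "card (pverts G - S)"
    have SV: "S \<subseteq> pverts G" and comp': "num_components (del_verts G S) = ?r" and "?r \<ge> 2"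
      using S num_components_in_part[OF A] by (auto simp: separators_def)
    have "?r \<le> card A" using A part_finite card_mono by blast
    then have "?r \<le> card M" using M(2)[OF A(1)] by simp
    then have "real ?n / card M \<le> real ?n / ?r"
      using \<open>?r \<ge> 2\<close> by (intro divide_left_mono) auto
    moreover have "real (card S) = real ?n - ?r"
      using vertices_outside[OF SV] by simp
    ultimately show "cut_ratio G ?S \<le> cut_ratio G S"
      using \<open>?r \<ge> 2\<close> M(3) unfolding ratio comp' by (simp add: diff_divide_distrib)
  qed
  then show ?thesis by (simp only: ratio)
qed

end

section \<open>Deleting an edge\<close>

lemma del_edge_commute: "del_edge G u v = del_edge G v u"
  by (simp add: del_edge_def insert_commute)

lemma pair_graph_del_edge:
  assumes "pair_graph G"
  shows "pair_graph (del_edge G u v)"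
proof -
  interpret G: pair_graph G by fact
  show ?thesis
    using G.pair_finite_verts G.pair_finite_arcs G.in_arcsD1 G.in_arcsD2 G.pair_no_loops G.arcs_symmetric
    by unfold_locales (auto simp: del_edge_def symmetric_def intro!: symI)
qed

lemma del_verts_del_edge:
  assumes "u \<in> S \<or> v \<in> S"
  shows "del_verts (del_edge G u v) S = del_verts G S"
  using assms by (auto simp: del_verts_def del_edge_def induce_subgraph_def with_proj_def)

context multipartite_graph
begin

text \<open>
  Among the remaining vertices, \<open>v\<close> had \<open>u\<close> as its only neighbour and becomes isolated, while \<open>u\<close> is
  still adjacent to all the others.
\<close>

lemma cut_after_del_edge:
  assumes AB: "A \<in> P" "B \<in> P" "A \<noteq> B" "u \<in> A" "v \<in> B"
    and R: "pverts G - S \<subseteq> insert u B" "u \<notin> S" "v \<notin> S"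
  shows "num_components (del_verts (del_edge G u v) S) = 2"
proof -
  let ?T = "pverts G - S - {u} - {v}"
  have in_G: "u \<in> pverts G" "v \<in> pverts G" using AB part_subset by auto
  have uv: "u \<noteq> v" using AB part_unique by metis
  have "x \<in> B" if "x \<in> ?T" for x using R(1) that by blast
  then have indep: "(v, x) \<notin> parcs G" "(x, u) \<in> parcs G" if "x \<in> ?T" for x
    using that AB adjacent_iff[of B B v x] adjacent_iff[of B A x u] by auto
  show ?thesis
  proof (rule num_components_star_and_isolated[where v = v and w = u and R = "insert u ?T"])
    show "pair_graph (del_edge G u v)" using pair_graph_axioms by (rule pair_graph_del_edge)
  qed (use in_G uv R(2,3) indep in \<open>auto simp: del_edge_def\<close>)
qed

text \<open>
  Suppose that both ends of the deleted edge remain. A remaining vertex outside \<open>A \<union> B\<close> is a hub, as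
  it is still adjacent to both ends. Otherwise, if \<open>A\<close> retains a second vertex \<open>a\<close> and \<open>B\<close> retains a
  second vertex \<open>b\<close>, then every vertex reaches \<open>b\<close>, namely \<open>v\<close> through \<open>a\<close> and the rest of \<open>B\<close>
  through \<open>u\<close>. So one of the two parts is reduced to its end of the edge.
\<close>

lemma separator_after_del_edge:
  assumes AB: "A \<in> P" "B \<in> P" "A \<noteq> B" "u \<in> A" "v \<in> B"
    and S: "S \<in> separators (del_edge G u v)" "u \<notin> S" "v \<notin> S"
  shows "pverts G - S \<subseteq> insert u B \<or> pverts G - S \<subseteq> insert v A"
proof (rule ccontr)
  assume contr: "\<not> ?thesis"
  let ?H = "del_edge G u v" and ?R = "pverts G - S"
  let ?E = "parcs ?H \<inter> ?R \<times> ?R"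
  have H: "pair_graph ?H" using pair_graph_axioms by (rule pair_graph_del_edge)
  have verts: "pverts ?H = pverts G" by (simp add: del_edge_def)
  have not_1: "num_components (del_verts ?H S) \<noteq> 1" using S by (auto simp: separators_def)
  have uv: "u \<in> ?R" "v \<in> ?R" using AB S part_subset by auto
  have edge: "(x, y) \<in> ?E"
    if "C \<in> P" "D \<in> P" "C \<noteq> D" "x \<in> C" "y \<in> D" "x \<in> ?R" "y \<in> ?R" "{x, y} \<noteq> {u, v}" for x y C D
    using that adjacent_iff[of C D x y] by (auto simp: del_edge_def)
  note two_steps = converse_rtrancl_into_rtrancl[OF _ r_into_rtrancl]
  show False
  proof (cases "?R \<subseteq> A \<union> B")
    case False
    then obtain w where w: "w \<in> ?R" "w \<notin> A" "w \<notin> B" by blast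
    then obtain C where C: "C \<in> P" "w \<in> C" using in_part by blast
    have "(z, w) \<in> ?E\<^sup>*" if z: "z \<in> ?R" for z
    proof -
      obtain D where D: "D \<in> P" "z \<in> D" using in_part z by blast
      show ?thesis
      proof (cases "D = C")
        case True
        then have "D \<noteq> A" "z \<noteq> v" using AB C D w part_unique by blast+
        then have "(z, u) \<in> ?E"
          using AB D z uv by (intro edge[of D A]) (auto simp: doubleton_eq_iff)
        moreover have "(u, w) \<in> ?E" using AB C w uv by (intro edge[of A C]) auto
        ultimately show ?thesis by (rule two_steps)
      next
        case False
        then show ?thesis using AB C D w z by (intro r_into_rtrancl edge[of D C]) auto
      qed
    qed
    with not_1 w(1) show False using num_components_hub[OF H, of w S] verts by simp
  next
    case True
    obtain a where a: "a \<in> ?R" "a \<in> A" "a \<noteq> u" using contr True by blast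
    obtain b where b: "b \<in> ?R" "b \<in> B" "b \<noteq> v" using contr True by blast
    have disj: "A \<inter> B = {}" using AB part_unique by blast
    have ub: "(u, b) \<in> ?E" using AB b uv disj by (intro edge[of A B]) auto
    have "(z, b) \<in> ?E\<^sup>*" if z: "z \<in> ?R" for z
    proof -
      consider "z \<in> A" | "z \<in> B" "z \<noteq> v" | "z = v" using True z by blast
      then show ?thesis
      proof cases
        case 1
        then have "(z, b) \<in> ?E" using AB b z disj by (intro edge[of A B]) auto
        then show ?thesis by blast
      next
        case 2
        then have "(z, u) \<in> ?E" using AB uv z disj by (intro edge[of B A]) auto
        then show ?thesis using ub by (rule two_steps)
      next
        case 3
        have "(v, a) \<in> ?E" using AB a uv disj by (intro edge[of B A]) auto
        moreover have "(a, b) \<in> ?E" using AB a b disj by (intro edge[of A B]) auto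
        ultimately show ?thesis unfolding 3 by (rule two_steps)
      qed
    qed
    with not_1 b(1) show False using num_components_hub[OF H, of b S] verts by simp
  qed
qed

lemma toughness_del_edge_less_if:
  assumes AB: "A \<in> P" "B \<in> P" "A \<noteq> B" "u \<in> A" "v \<in> B"
    and less: "(real (card (pverts G)) - card B - 1) / 2 < t"
  shows "toughness (del_edge G u v) < ereal t"
proof -
  let ?H = "del_edge G u v" and ?S = "pverts G - insert u B"
  have "u \<notin> B" using AB part_unique by metis
  then have card: "card (insert u B) = card B + 1" using part_finite[OF AB(2)] by simp
  have sub: "insert u B \<subseteq> pverts G" using AB part_subset by auto
  have comp: "num_components (del_verts ?H ?S) = 2"
    by (rule cut_after_del_edge[OF AB]) (use AB in auto)
  then have "?S \<in> separators ?H" by (auto simp: separators_def del_edge_def)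
  moreover have fin: "finite (pverts ?H)" using pair_finite_verts by (simp add: del_edge_def)
  moreover have "cut_ratio ?H ?S = (real (card (pverts G)) - card B - 1) / 2"
    using comp card vertices_outside[OF sub] by (simp add: of_nat_diff)
  ultimately show ?thesis
    using less toughness_less_iff[OF fin] by metis
qed

text \<open>
  A separator of \<open>G - uv\<close> that contains \<open>u\<close> or \<open>v\<close> also separates \<open>G\<close>, with the same ratio, and cannot
  beat the toughness of \<open>G\<close>. The remaining ones leave two components and at most \<open>card A + 1\<close> or
  \<open>card B + 1\<close> vertices; keeping all of the larger part and the opposite end attains this bound.
\<close>

lemma toughness_del_edge_less_iff:
  assumes AB: "A \<in> P" "B \<in> P" "A \<noteq> B" "u \<in> A" "v \<in> B"
    and t: "toughness G = ereal t"
  shows "toughness (del_edge G u v) < ereal t \<longleftrightarrow>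
    (real (card (pverts G)) - max (card A) (card B) - 1) / 2 < t"
proof
  let ?H = "del_edge G u v" and ?n = "card (pverts G)"
  let ?m = "max (card A) (card B)"
  assume "toughness ?H < ereal t"
  then obtain S where S: "S \<in> separators ?H" "cut_ratio ?H S < t"
    using pair_finite_verts by (subst (asm) toughness_less_iff) (auto simp: del_edge_def)
  then have SV: "S \<subseteq> pverts G" by (simp add: separators_def del_edge_def)
  have uv: "u \<notin> S" "v \<notin> S"
  proof -
    have "\<not> (u \<in> S \<or> v \<in> S)"
    proof
      assume "u \<in> S \<or> v \<in> S"
      then have same: "del_verts ?H S = del_verts G S" by (rule del_verts_del_edge)
      then have "S \<in> separators G" using S(1) SV by (simp add: separators_def)
      then have "toughness G < ereal t"
        using S(2) same toughness_less_iff[OF pair_finite_verts] by metis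
      with t show False by simp
    qed
    then show "u \<notin> S" "v \<notin> S" by auto
  qed
  have "num_components (del_verts ?H S) = 2 \<and> card (pverts G - S) \<le> ?m + 1"
    using separator_after_del_edge[OF AB S(1) uv]
  proof
    assume sub: "pverts G - S \<subseteq> insert u B"
    have "card (pverts G - S) \<le> card (insert u B)"
      using sub part_finite AB by (intro card_mono) auto
    then show ?thesis
      using cut_after_del_edge[OF AB sub uv] part_finite AB by (auto simp: card_insert_if split: if_splits)
  next
    assume sub: "pverts G - S \<subseteq> insert v A"
    have "card (pverts G - S) \<le> card (insert v A)"
      using sub part_finite AB by (intro card_mono) auto
    then show ?thesis
      using cut_after_del_edge[OF AB(2,1) AB(3)[symmetric] AB(5,4) sub uv(2,1)] part_finite AB
      by (auto simp: card_insert_if del_edge_commute[of G u v] split: if_splits)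
  qed
  moreover have "real (card S) = real ?n - card (pverts G - S)"
    using vertices_outside[OF SV] by simp
  ultimately show "(real ?n - ?m - 1) / 2 < t" using S(2) by simp
next
  assume less: "(real (card (pverts G)) - max (card A) (card B) - 1) / 2 < t"
  show "toughness (del_edge G u v) < ereal t"
  proof (cases "card A \<le> card B")
    case True
    then show ?thesis using less by (intro toughness_del_edge_less_if[OF AB]) (simp add: max_def)
  next
    case False
    then show ?thesis
      using less unfolding del_edge_commute[of G u v]
      by (intro toughness_del_edge_less_if[OF AB(2,1) AB(3)[symmetric] AB(5,4)]) (simp add: max_def)
  qed
qed

end

section \<open>Minimal toughness in terms of the part sizes\<close>

text \<open>
  The four families \<open>K\<^bsub>2,3\<^esub>\<close>, \<open>K\<^bsub>1,l\<^esub>\<close>, \<open>T\<^bsub>2l,l\<^esub>\<close> and \<open>T\<^bsub>2l-1,l\<^esub>\<close>, read off from a partition into parts. Since only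
  cardinalities occur, the property is preserved when the partition is mapped injectively, which makes
  it easy to move along isomorphisms.
\<close>

definition tough_parts :: "nat \<Rightarrow> 'a set set \<Rightarrow> bool" where
  "tough_parts l P \<longleftrightarrow>
    (\<exists>A B. P = {A, B} \<and> A \<noteq> B \<and> (card A = 2 \<and> card B = 3 \<or> card A = 1 \<and> card B = l)) \<or>
    (card P = l \<and> ((\<forall>A \<in> P. card A = 2) \<or> (\<exists>A \<in> P. card A = 1 \<and> (\<forall>B \<in> P - {A}. card B = 2))))"

context multipartite_graph
begin

lemma card_verts: "card (pverts G) = (\<Sum>A \<in> P. card A)"
  using partition_onD1[OF part] partition_onD2[OF part] part_finite
  by (simp add: card_Union_disjoint)

lemma card_part_pos: "A \<in> P \<Longrightarrow> card A > 0"
  using part_nonempty part_finite by (simp add: card_gt_0_iff)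

lemma card_verts_ge:
  assumes "Q \<subseteq> P"
  shows "(\<Sum>A \<in> Q. card A) \<le> card (pverts G)"
  unfolding card_verts using finite_parts assms by (intro sum_mono2) auto

lemma complete_iff: "(\<exists>n. complete_digraph n (with_proj G)) \<longleftrightarrow> (\<forall>A \<in> P. card A \<le> 1)"
proof
  assume "\<exists>n. complete_digraph n (with_proj G)"
  then have E: "parcs G = {(u, v). (u, v) \<in> pverts G \<times> pverts G \<and> u \<noteq> v}"
    by (auto simp: complete_digraph_pair_def)
  show "\<forall>A \<in> P. card A \<le> 1"
  proof
    fix A assume A: "A \<in> P"
    have "x = y" if "x \<in> A" "y \<in> A" for x y
      using that A E adjacent_iff[OF A A that] part_subset[OF A] by auto
    then show "card A \<le> 1" using part_finite[OF A] by (simp add: card_le_Suc0_iff_eq)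
  qed
next
  assume le: "\<forall>A \<in> P. card A \<le> 1"
  have "(u, v) \<in> parcs G \<longleftrightarrow> u \<in> pverts G \<and> v \<in> pverts G \<and> u \<noteq> v" for u v
  proof (cases "u \<in> pverts G \<and> v \<in> pverts G")
    case True
    then obtain A B where AB: "A \<in> P" "u \<in> A" "B \<in> P" "v \<in> B" using in_part by blast
    have "A = B \<longleftrightarrow> u = v"
    proof
      assume "A = B"
      then have "\<forall>x \<in> A. \<forall>y \<in> A. x = y"
        using le AB(1) card_le_Suc0_iff_eq[OF part_finite[OF AB(1)]] by simp
      then show "u = v" using AB \<open>A = B\<close> by blast
    qed (use AB part_unique in blast)
    then show ?thesis using AB adjacent_iff[of A B u v] True by simp
  next
    case False
    then show ?thesis using in_arcsD1 in_arcsD2 by blast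
  qed
  then have "complete_digraph (card (pverts G)) (with_proj G)"
    using pair_finite_verts by (auto simp: complete_digraph_pair_def)
  then show "\<exists>n. complete_digraph n (with_proj G)" by blast
qed

text \<open>
  The graph is complete if and only if its largest parts are singletons, and edgeless if and only if it
  has no second part. Every pair of distinct parts is joined by an edge, so minimality is a condition
  on pairs of parts.
\<close>

lemma nontrivially_minimally_tough_iff:
  assumes M: "M \<in> P" "\<And>A. A \<in> P \<Longrightarrow> card A \<le> card M"
  shows "nontrivially_minimally_tough G \<longleftrightarrow>
    card M \<ge> 2 \<and> (\<exists>C \<in> P. C \<noteq> M) \<and>
    (\<forall>A \<in> P. \<forall>B \<in> P. A \<noteq> B \<longrightarrow>
      (real (card (pverts G)) - max (card A) (card B) - 1) / 2
        < (real (card (pverts G)) - card M) / card M)"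
    (is "_ \<longleftrightarrow> _ \<and> _ \<and> ?cond")
proof -
  let ?t = "(real (card (pverts G)) - card M) / card M"
  have complete: "(\<exists>n. complete_digraph n (with_proj G)) \<longleftrightarrow> \<not> card M \<ge> 2"
  proof -
    have "(\<forall>A \<in> P. card A \<le> 1) \<longleftrightarrow> card M \<le> 1" using M by (meson le_trans)
    then show ?thesis unfolding complete_iff by linarith
  qed
  have edges: "parcs G \<noteq> {} \<longleftrightarrow> (\<exists>C \<in> P. C \<noteq> M)"
  proof
    assume "parcs G \<noteq> {}"
    then obtain u v where "(u, v) \<in> parcs G" by auto
    then show "\<exists>C \<in> P. C \<noteq> M" by (elim edge_parts) metis
  next
    assume "\<exists>C \<in> P. C \<noteq> M"
    then obtain C where C: "C \<in> P" "C \<noteq> M" by blast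
    obtain x y where "x \<in> C" "y \<in> M" using part_nonempty C(1) M(1) by blast
    then have "(x, y) \<in> parcs G" using adjacent_iff C M(1) by simp
    then show "parcs G \<noteq> {}" by auto
  qed
  have minimal: "minimally_tough G \<longleftrightarrow> ?cond" if "card M \<ge> 2"
  proof -
    have t: "toughness G = ereal ?t" using toughness_eq M that by blast
    then have "minimally_tough G \<longleftrightarrow>
        (\<forall>u v. (u, v) \<in> parcs G \<longrightarrow> toughness (del_edge G u v) < ereal ?t)"
      by (auto simp: minimally_tough_def minimally_t_tough_def)
    also have "\<dots> \<longleftrightarrow> ?cond"
    proof
      assume less: "\<forall>u v. (u, v) \<in> parcs G \<longrightarrow> toughness (del_edge G u v) < ereal ?t"
      show ?cond
      proof (intro ballI impI)
        fix A B assume AB: "A \<in> P" "B \<in> P" "A \<noteq> B"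
        obtain u v where uv: "u \<in> A" "v \<in> B" using part_nonempty AB by blast
        then have "(u, v) \<in> parcs G" using AB adjacent_iff by simp
        then show "(real (card (pverts G)) - max (card A) (card B) - 1) / 2 < ?t"
          using less toughness_del_edge_less_iff[OF AB uv t] by blast
      qed
    next
      assume cond: ?cond
      show "\<forall>u v. (u, v) \<in> parcs G \<longrightarrow> toughness (del_edge G u v) < ereal ?t"
      proof (intro allI impI)
        fix u v assume "(u, v) \<in> parcs G"
        then obtain A B where AB: "A \<in> P" "B \<in> P" "u \<in> A" "v \<in> B" "A \<noteq> B" by (rule edge_parts)
        then show "toughness (del_edge G u v) < ereal ?t"
          using cond toughness_del_edge_less_iff[OF AB(1,2,5,3,4) t] by blast
      qed
    qed
    finally show ?thesis .
  qed
  show ?thesis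
    unfolding nontrivially_minimally_tough_def complete edges
    using minimal by (cases "card M \<ge> 2") (simp_all only: simp_thms conj_commute)
qed

lemma exists_largest_part:
  assumes "P \<noteq> {}"
  obtains M where "M \<in> P" "\<And>A. A \<in> P \<Longrightarrow> card A \<le> card M"
proof -
  have "Max (card ` P) \<in> card ` P" using assms finite_parts by (intro Max_in) auto
  then obtain M where "M \<in> P" "card M = Max (card ` P)" by force
  then show ?thesis using that finite_parts by simp
qed

end

text \<open>
  Here \<open>n\<close> is the number of vertices, \<open>m\<close> the size of a largest part and \<open>x\<close> the size of the larger of
  the two parts joined by the deleted edge. Clearing denominators moves the condition to the natural
  numbers, where the case analysis is done.
\<close>

lemma edge_condition_nat:
  fixes n x m :: nat
  assumes "m > 0"
  shows "(real n - real x - 1) / 2 < (real n - real m) / real m \<longleftrightarrow>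
    m * n + m < 2 * n + m * x"
proof -
  have "(real n - real x - 1) / 2 < (real n - real m) / real m \<longleftrightarrow>
      real (m * n + m) < real (2 * n + m * x)"
    using assms by (simp add: field_simps)
  then show ?thesis by (simp only: of_nat_less_iff)
qed

text \<open>
  With only two parts, of sizes \<open>m\<close> and \<open>c\<close>, and \<open>x = m\<close>, the condition amounts to
  \<open>(m - 2) * c < m\<close>. For \<open>m \<ge> 3\<close> this fails from \<open>c = 3\<close> on, and \<open>c = 2\<close> forces \<open>m < 4\<close>. The
  substitution \<open>m = k + 3\<close> avoids truncated subtraction.
\<close>

lemma two_part_sizes:
  fixes m c :: nat
  assumes "m \<ge> 3" "c > 0" "m * (m + c) + m < 2 * (m + c) + m * m"
  shows "c = 1 \<or> c = 2 \<and> m = 3"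
proof -
  obtain k where k: "m = k + 3" using assms(1) by (metis add.commute le_Suc_ex)
  have "(k + 1) * c < k + 3" using assms(3) by (simp add: k algebra_simps)
  moreover have "(k + 1) * 3 \<le> (k + 1) * c" if "c \<ge> 3" using that by (rule mult_le_mono2)
  ultimately have "c < 3" by (cases "c \<ge> 3") auto
  then have "c = 1 \<or> c = 2" using assms(2) by linarith
  with \<open>(k + 1) * c < k + 3\<close> k show ?thesis by auto
qed

text \<open>
  For parts \<open>C\<close> and \<open>D\<close> different from a largest part, with \<open>x\<close> the larger of their sizes, the number
  of vertices is at least \<open>m + x + 1\<close>. Inserted into the condition \<open>(m - 2) * n < m * x - m\<close> this
  yields \<open>m * m < 2 * x + 2 \<le> 2 * m + 2\<close>, which is impossible for \<open>m \<ge> 3\<close>.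
\<close>

lemma three_part_sizes:
  fixes m n x :: nat
  assumes "m \<ge> 3" "x \<le> m" "n \<ge> m + x + 1"
  shows "\<not> m * n + m < 2 * n + m * x"
proof
  assume less: "m * n + m < 2 * n + m * x"
  obtain k where k: "m = k + 3" using assms(1) by (metis add.commute le_Suc_ex)
  have "(k + 1) * (m + x + 1) \<le> (k + 1) * n" using assms(3) by (rule mult_le_mono2)
  then show False using less assms(2) by (simp add: k algebra_simps)
qed

context multipartite_graph
begin

text \<open>
  If a largest part has size 2, the condition for two parts says that one of them has size 2, so at most
  one part is a singleton. If it has size at least 3, a third part is excluded by testing an edge that
  avoids the largest part, and two parts leave only \<open>K\<^bsub>1,m\<^esub>\<close> and \<open>K\<^bsub>2,3\<^esub>\<close>.
\<close>

lemma nontrivially_minimally_tough_iff_parts: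
  "nontrivially_minimally_tough G \<longleftrightarrow> (\<exists>l \<ge> 2. tough_parts l P)"
proof (cases "P = {}")
  case True
  then have "parcs G = {}" by (auto elim: edge_parts)
  with True show ?thesis by (auto simp: nontrivially_minimally_tough_def tough_parts_def)
next
  case False
  then obtain M where M: "M \<in> P" "\<And>A. A \<in> P \<Longrightarrow> card A \<le> card M" by (rule exists_largest_part) blast
  define m where "m = card M"
  define n where "n = card (pverts G)"
  have tough_iff: "nontrivially_minimally_tough G \<longleftrightarrow> m \<ge> 2 \<and> (\<exists>C \<in> P. C \<noteq> M) \<and>
      (\<forall>A \<in> P. \<forall>B \<in> P. A \<noteq> B \<longrightarrow> m * n + m < 2 * n + m * max (card A) (card B))"
    unfolding m_def n_def edge_condition_nat[OF card_part_pos[OF M(1)], symmetric]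
    by (rule nontrivially_minimally_tough_iff[OF M(1)]) (rule M(2))
  show ?thesis
  proof
    assume "nontrivially_minimally_tough G"
    then obtain C where m2: "m \<ge> 2" and C: "C \<in> P" "C \<noteq> M"
      and cond: "\<And>A B. A \<in> P \<Longrightarrow> B \<in> P \<Longrightarrow> A \<noteq> B \<Longrightarrow> m * n + m < 2 * n + m * max (card A) (card B)"
      unfolding tough_iff by blast
    have "card {M, C} \<le> card P" using finite_parts C M by (intro card_mono) auto
    then have P2: "card P \<ge> 2" using C by simp
    have le: "card A \<le> m" if "A \<in> P" for A using M(2)[OF that] by (simp add: m_def)
    consider "m = 2" | "m \<ge> 3" "P = {M, C}" | "m \<ge> 3" "P \<noteq> {M, C}" using m2 by linarith
    then show "\<exists>l \<ge> 2. tough_parts l P"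
    proof cases
      case 1
      have "tough_parts (card P) P"
      proof (cases "\<forall>A \<in> P. card A = 2")
        case False
        then obtain A where A: "A \<in> P" "card A \<noteq> 2" by blast
        then have A1: "card A = 1" using le[OF A(1)] card_part_pos[OF A(1)] 1 by linarith
        have "card B = 2" if "B \<in> P - {A}" for B
        proof -
          have "card B \<le> 2" using le[of B] that 1 by simp
          moreover have "max (card A) (card B) > 1" using cond[of A B] A that 1 by auto
          ultimately show ?thesis using A1 by linarith
        qed
        with A A1 show ?thesis unfolding tough_parts_def by blast
      qed (simp add: tough_parts_def)
      with P2 show ?thesis by blast
    next
      case 2
      let ?c = "card C"
      have n: "n = m + ?c" using C(2) by (simp add: n_def m_def card_verts 2(2))
      have "m * (m + ?c) + m < 2 * (m + ?c) + m * m"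
        using cond[OF M(1) C(1)] C(2) le[OF C(1)] by (auto simp: n m_def[symmetric] max_def split: if_splits)
      then have "?c = 1 \<or> ?c = 2 \<and> m = 3"
        using two_part_sizes[OF 2(1) card_part_pos[OF C(1)]] by blast
      then have "tough_parts m {C, M}" unfolding tough_parts_def m_def using C(2) by blast
      moreover have "{C, M} = P" using 2(2) by blast
      ultimately show ?thesis using m2 by auto
    next
      case 3
      then obtain D where D: "D \<in> P" "D \<noteq> M" "D \<noteq> C" using M C by blast
      \<comment> \<open>An edge between \<open>C\<close> and \<open>D\<close> avoids the largest part, so its own two parts are too small.\<close>
      have "(\<Sum>A \<in> {M, C, D}. card A) \<le> n"
        unfolding n_def using M C D by (intro card_verts_ge) auto
      then have "m + card C + card D \<le> n" using C D by (simp add: m_def)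
      then have "m + max (card C) (card D) + 1 \<le> n"
        using card_part_pos[OF C(1)] card_part_pos[OF D(1)] by linarith
      moreover have "max (card C) (card D) \<le> m" using le C D by simp
      ultimately have False using three_part_sizes[OF 3(1)] cond[OF C(1) D(1)] D(3) by blast
      then show ?thesis ..
    qed
  next
    assume "\<exists>l \<ge> 2. tough_parts l P"
    then obtain l where l: "l \<ge> 2" "tough_parts l P" by blast
    show "nontrivially_minimally_tough G"
    proof (cases "\<exists>A B. P = {A, B} \<and> A \<noteq> B \<and>
        (card A = 2 \<and> card B = 3 \<or> card A = 1 \<and> card B = l)")
      case True
      then obtain A B where AB: "P = {A, B}" "A \<noteq> B"
        and sizes: "card A = 2 \<and> card B = 3 \<or> card A = 1 \<and> card B = l" by blast
      have less: "card A < card B" using sizes l(1) by auto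
      then have "M = B" using M AB by force
      then have m: "m = card B" by (simp add: m_def)
      have n: "n = card A + card B" using AB by (simp add: n_def card_verts)
      have "m * n + m < 2 * n + m * m" using sizes by (auto simp: m n algebra_simps)
      then show ?thesis
        unfolding tough_iff using AB less sizes l(1) \<open>M = B\<close> by (auto simp: m max_def)
    next
      case False
      then have P: "card P = l" and sizes: "(\<forall>A \<in> P. card A = 2) \<or>
          (\<exists>A \<in> P. card A = 1 \<and> (\<forall>B \<in> P - {A}. card B = 2))"
        using l(2) unfolding tough_parts_def by blast+
      have le2: "card A \<le> 2" if "A \<in> P" for A using sizes that by force
      have max: "max (card A) (card B) = 2" if "A \<in> P" "B \<in> P" "A \<noteq> B" for A B
      proof -
        have "card A = 2 \<or> card B = 2" using sizes that by blast
        then show ?thesis using le2[OF that(1)] le2[OF that(2)] by linarith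
      qed
      have other: "\<exists>C \<in> P. C \<noteq> A" if "A \<in> P" for A
      proof (rule ccontr)
        assume "\<not> ?thesis"
        then have "P \<subseteq> {A}" by blast
        then have "card P \<le> card {A}" by (intro card_mono) auto
        with P l(1) show False by simp
      qed
      obtain C where C: "C \<in> P" "C \<noteq> M" using other[OF M(1)] by blast
      have "m = 2" using max[OF M(1) C(1)] C(2) M(2)[OF C(1)] by (simp add: m_def max_def)
      then show ?thesis unfolding tough_iff using C max by auto
    qed
  qed
qed

end

section \<open>The listed graphs and their part sizes\<close>

text \<open>
  Positive sizes are required because the parts of a partition are nonempty, whereas a side of a
  complete bipartite graph may be empty.
\<close>

lemma complete_bipartite_iff_parts:
  assumes "m > 0" "k > 0"
  shows "complete_bipartite_digraph m k (with_proj H) \<longleftrightarrow>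
    (\<exists>A B. A \<noteq> B \<and> complete_multipartite_with H {A, B} \<and> card A = m \<and> card B = k)"
proof
  assume K: "complete_bipartite_digraph m k (with_proj H)"
  then obtain U V where UV: "pverts H = U \<union> V" "U \<inter> V = {}" "card U = m" "card V = k"
      "parcs H = U \<times> V \<union> V \<times> U"
    by (auto simp: complete_bipartite_digraph_pair_def)
  then have "U \<noteq> {}" "V \<noteq> {}" using assms by auto
  then have "U \<noteq> V" "partition_on (pverts H) {U, V}"
    using UV by (auto simp: partition_on_def disjoint_def)
  moreover have "pair_graph H" using K by (rule pair_graphI_complete_bipartite)
  ultimately have "complete_multipartite_with H {U, V}"
    using UV by (auto simp: complete_multipartite_with_def)
  with UV \<open>U \<noteq> V\<close> show "\<exists>A B. A \<noteq> B \<and> complete_multipartite_with H {A, B} \<and> card A = m \<and> card B = k"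
    by blast
next
  assume "\<exists>A B. A \<noteq> B \<and> complete_multipartite_with H {A, B} \<and> card A = m \<and> card B = k"
  then obtain A B where AB: "A \<noteq> B" "complete_multipartite_with H {A, B}" "card A = m" "card B = k"
    by blast
  then interpret H: multipartite_graph H "{A, B}" by unfold_locales
  have "pverts H = A \<union> B" "A \<inter> B = {}"
    using partition_onD1[OF H.part] partition_onD2[OF H.part] AB(1) by (simp_all add: disjoint_def)
  moreover have "parcs H = A \<times> B \<union> B \<times> A"
    using H.adjacent_iff[of A B] H.adjacent_iff[of B A] AB(1) by (auto elim!: H.edge_parts)
  ultimately show "complete_bipartite_digraph m k (with_proj H)"
    using AB H.pair_finite_verts unfolding complete_bipartite_digraph_pair_def by blast
qed

text \<open>
  The sizes average to 2. Parts that differ in size by at most one then cannot deviate from 2: a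
  part larger than 2 would make all others at least 2, and a part smaller than 2 all others at most 2.
\<close>

lemma (in multipartite_graph) equal_sizes_iff:
  assumes "card P = l"
  shows "card (pverts G) = 2 * l \<and> (\<forall>A \<in> P. \<forall>B \<in> P. card A \<le> card B + 1) \<longleftrightarrow>
    (\<forall>A \<in> P. card A = 2)"
proof
  assume bal: "card (pverts G) = 2 * l \<and> (\<forall>A \<in> P. \<forall>B \<in> P. card A \<le> card B + 1)"
  then have sum: "(\<Sum>A \<in> P. card A) = (\<Sum>A \<in> P. 2)" using assms card_verts by simp
  show "\<forall>A \<in> P. card A = 2"
  proof (rule ccontr)
    assume "\<not> ?thesis"
    then obtain A where A: "A \<in> P" "card A \<noteq> 2" by blast
    consider "card A > 2" | "card A < 2" using A by linarith
    then show False
    proof cases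
      case 1
      then have "\<forall>B \<in> P. 2 \<le> card B" using bal A by force
      then have "(\<Sum>A \<in> P. 2) < (\<Sum>A \<in> P. card A)"
        using 1 A finite_parts by (intro sum_strict_mono_ex1) auto
      with sum show False by simp
    next
      case 2
      then have "\<forall>B \<in> P. card B \<le> 2" using bal A by force
      then have "(\<Sum>A \<in> P. card A) < (\<Sum>A \<in> P. 2)"
        using 2 A finite_parts by (intro sum_strict_mono_ex1) auto
      with sum show False by simp
    qed
  qed
qed (use assms card_verts in auto)

text \<open>
  The vertices are too few for all parts to have size at least 2, so there is a singleton, and balance
  bounds all other parts by 2. Their average is then exactly 2, hence each of them has size 2.
\<close>

lemma (in multipartite_graph) one_small_part_iff:
  assumes "card P = l" "l > 0"
  shows "card (pverts G) = 2 * l - 1 \<and> (\<forall>A \<in> P. \<forall>B \<in> P. card A \<le> card B + 1) \<longleftrightarrow>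
    (\<exists>A \<in> P. card A = 1 \<and> (\<forall>B \<in> P - {A}. card B = 2))"
proof
  assume bal: "card (pverts G) = 2 * l - 1 \<and> (\<forall>A \<in> P. \<forall>B \<in> P. card A \<le> card B + 1)"
  have "\<exists>A \<in> P. card A < 2"
  proof (rule ccontr)
    assume "\<not> ?thesis"
    then have "(\<Sum>A \<in> P. 2) \<le> (\<Sum>A \<in> P. card A)" by (intro sum_mono) auto
    then show False using assms bal card_verts by simp
  qed
  then obtain A where A: "A \<in> P" "card A = 1" using card_part_pos by force
  have le: "\<forall>B \<in> P. card B \<le> 2" using bal A by force
  have "(\<Sum>B \<in> P. card B) = card A + (\<Sum>B \<in> P - {A}. card B)"
    using finite_parts A(1) by (rule sum.remove)
  then have "1 + (\<Sum>B \<in> P - {A}. card B) = 2 * l - 1"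
    using bal card_verts A(2) by simp
  moreover have "(\<Sum>B \<in> P - {A}. 2) = 2 * (l - 1)"
    using assms A(1) by simp
  ultimately have sum: "(\<Sum>B \<in> P - {A}. card B) = (\<Sum>B \<in> P - {A}. 2)" by linarith
  have "\<forall>B \<in> P - {A}. card B = 2"
  proof (rule ccontr)
    assume "\<not> ?thesis"
    then have "\<exists>B \<in> P - {A}. card B < 2" using le by force
    then have "(\<Sum>B \<in> P - {A}. card B) < (\<Sum>B \<in> P - {A}. 2)"
      using le finite_parts by (intro sum_strict_mono_ex1) auto
    with sum show False by simp
  qed
  with A show "\<exists>A \<in> P. card A = 1 \<and> (\<forall>B \<in> P - {A}. card B = 2)" by blast
next
  assume "\<exists>A \<in> P. card A = 1 \<and> (\<forall>B \<in> P - {A}. card B = 2)"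
  then obtain A where A: "A \<in> P" "card A = 1" "\<forall>B \<in> P - {A}. card B = 2" by blast
  have "(\<Sum>B \<in> P. card B) = card A + (\<Sum>B \<in> P - {A}. card B)"
    using finite_parts A(1) by (rule sum.remove)
  then have "card (pverts G) = 2 * l - 1" using assms A card_verts finite_parts by simp
  moreover have "card B \<le> 2" "card B \<ge> 1" if "B \<in> P" for B using A that by force+
  then have "\<forall>A \<in> P. \<forall>B \<in> P. card A \<le> card B + 1" by fastforce
  ultimately show "card (pverts G) = 2 * l - 1 \<and> (\<forall>A \<in> P. \<forall>B \<in> P. card A \<le> card B + 1)"
    by (rule conjI)
qed

text \<open>
  All four families become one existential statement about a partition into parts. This is the form
  that isomorphisms transport, and any witness of it is a partition to which the characterisation of
  minimal toughness applies.
\<close>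

lemma listed_graphs_iff_parts:
  fixes H :: "'a pair_pre_digraph"
  assumes "l \<ge> 2"
  shows "complete_bipartite_digraph 2 3 (with_proj H) \<or> complete_bipartite_digraph 1 l (with_proj H) \<or>
      turan (2 * l) l H \<or> turan (2 * l - 1) l H \<longleftrightarrow>
    (\<exists>P. complete_multipartite_with H P \<and> tough_parts l P)"
proof -
  let ?equal = "\<lambda>P. \<forall>A \<in> P. card A = 2"
  let ?one_small = "\<lambda>P. \<exists>A \<in> P. card A = 1 \<and> (\<forall>B \<in> P - {A}. card B = 2)"
  let ?two = "\<lambda>A B. card A = 2 \<and> card B = 3 \<or> card A = 1 \<and> card B = l"
  have l: "0 < l" using assms by simp
  have bipartite: "complete_bipartite_digraph 2 3 (with_proj H) \<or> complete_bipartite_digraph 1 l (with_proj H) \<longleftrightarrow>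
      (\<exists>A B. A \<noteq> B \<and> complete_multipartite_with H {A, B} \<and> ?two A B)"
    unfolding complete_bipartite_iff_parts[OF zero_less_numeral zero_less_numeral]
      complete_bipartite_iff_parts[OF zero_less_one l]
    by (simp only: conj_disj_distribL ex_disj_distrib)
  \<comment> \<open>Two purely logical rearrangements: eliminating the variable \<open>P = {A, B}\<close>, and using
      \<open>card P = l\<close> as a premise for counting vertices.\<close>
  have one_point: "(\<exists>P A B. c P \<and> P = p A B \<and> A \<noteq> B \<and> s A B) \<longleftrightarrow> (\<exists>A B. A \<noteq> B \<and> c (p A B) \<and> s A B)"
    for c :: "'a set set \<Rightarrow> bool" and p :: "'a set \<Rightarrow> 'a set \<Rightarrow> 'a set set" and s
    by blast
  have regroup: "c \<and> n \<and> k \<and> b \<longleftrightarrow> c \<and> k \<and> s" if "c \<Longrightarrow> k \<Longrightarrow> n \<and> b \<longleftrightarrow> s" for c n k b s :: bool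
    using that by blast
  have even: "turan (2 * l) l H \<longleftrightarrow> (\<exists>P. complete_multipartite_with H P \<and> card P = l \<and> ?equal P)"
    unfolding turan_def
    by (intro ex_cong1 regroup multipartite_graph.equal_sizes_iff multipartite_graph.intro)
  have odd: "turan (2 * l - 1) l H \<longleftrightarrow>
      (\<exists>P. complete_multipartite_with H P \<and> card P = l \<and> ?one_small P)"
    unfolding turan_def
    by (intro ex_cong1 regroup multipartite_graph.one_small_part_iff multipartite_graph.intro l)
  have tough: "tough_parts l P \<longleftrightarrow>
      (\<exists>A B. P = {A, B} \<and> A \<noteq> B \<and> ?two A B) \<or> card P = l \<and> ?equal P \<or> card P = l \<and> ?one_small P" for P :: "'a set set"
    unfolding tough_parts_def by (simp only: conj_disj_distribL)
  have "(\<exists>P. complete_multipartite_with H P \<and> tough_parts l P) \<longleftrightarrow>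
      (\<exists>P A B. complete_multipartite_with H P \<and> P = {A, B} \<and> A \<noteq> B \<and> ?two A B) \<or>
      (\<exists>P. complete_multipartite_with H P \<and> card P = l \<and> ?equal P) \<or>
      (\<exists>P. complete_multipartite_with H P \<and> card P = l \<and> ?one_small P)"
    unfolding tough by (simp only: conj_disj_distribL ex_disj_distrib ex_simps)
  also have "(\<exists>P A B. complete_multipartite_with H P \<and> P = {A, B} \<and> A \<noteq> B \<and> ?two A B) \<longleftrightarrow>
      (\<exists>A B. A \<noteq> B \<and> complete_multipartite_with H {A, B} \<and> ?two A B)"
    by (rule one_point)
  finally show ?thesis unfolding even odd bipartite[symmetric] by (simp only: disj_assoc)
qed

lemma tough_parts_image:
  assumes "tough_parts l P" "inj_on f (\<Union> P)"
  shows "tough_parts l ((`) f ` P)"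
proof -
  define Q where "Q = (`) f ` P"
  have size: "card (f ` A) = card A" if "A \<in> P" for A
    using assms(2) that by (intro card_image) (auto intro: inj_on_subset)
  have inj: "inj_on ((`) f) P"
    using assms(2) by (rule inj_on_image)
  have card_Q: "card Q = card P" unfolding Q_def using inj by (rule card_image)
  consider A B where "P = {A, B}" "A \<noteq> B" "card A = 2 \<and> card B = 3 \<or> card A = 1 \<and> card B = l"
    | "card P = l" "\<forall>A \<in> P. card A = 2"
    | A where "card P = l" "A \<in> P" "card A = 1" "\<forall>B \<in> P - {A}. card B = 2"
    using assms(1) unfolding tough_parts_def by blast
  then have "tough_parts l Q"
  proof cases
    case (1 A B)
    have AB: "A \<in> P" "B \<in> P" using 1(1) by simp_all
    have "Q = {f ` A, f ` B}" using 1(1) by (simp add: Q_def)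
    moreover have "f ` A \<noteq> f ` B" using AB 1(2) inj_onD[OF inj, of A B] by blast
    moreover have "card (f ` A) = 2 \<and> card (f ` B) = 3 \<or> card (f ` A) = 1 \<and> card (f ` B) = l"
      unfolding size[OF AB(1)] size[OF AB(2)] by (rule 1(3))
    ultimately have "\<exists>A B. Q = {A, B} \<and> A \<noteq> B \<and>
        (card A = 2 \<and> card B = 3 \<or> card A = 1 \<and> card B = l)"
      by (intro exI conjI)
    then show ?thesis unfolding tough_parts_def by (rule disjI1)
  next
    case 2
    then have "\<forall>B \<in> Q. card B = 2" by (simp add: Q_def size)
    with 2(1) show ?thesis by (simp add: tough_parts_def card_Q)
  next
    case (3 A)
    have "f ` A \<in> Q" "card (f ` A) = 1" using 3(2,3) by (simp_all add: Q_def size)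
    moreover have "\<forall>B \<in> Q - {f ` A}. card B = 2" using 3(4) by (auto simp: Q_def size)
    ultimately show ?thesis using 3(1) card_Q unfolding tough_parts_def by blast
  qed
  then show ?thesis by (simp only: Q_def)
qed

section \<open>Transport along isomorphisms\<close>

definition image_graph :: "('a \<Rightarrow> 'b) \<Rightarrow> 'a pair_pre_digraph \<Rightarrow> 'b pair_pre_digraph" where
  "image_graph f G = \<lparr>pverts = f ` pverts G, parcs = map_prod f f ` parcs G\<rparr>"

lemma digraph_iso_imp_image_graph:
  assumes "digraph_iso (with_proj G) (with_proj H)"
  obtains f where "inj_on f (pverts G)" "H = image_graph f G"
proof -
  obtain h where h: "pre_digraph.digraph_isomorphism (with_proj G) h"
      "with_proj H = app_iso h (with_proj G)"
    using assms by (auto simp: digraph_iso_def)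
  have wf: "wf_digraph (with_proj G)"
    using h(1) by (simp add: pre_digraph.digraph_isomorphism_def)
  have "pverts H = iso_verts h ` pverts G"
    using arg_cong[OF h(2), of verts] by simp
  moreover have "parcs H = map_prod (iso_verts h) (iso_verts h) ` parcs G"
    using wf_digraph.arcs_ends_app_iso_eq[OF wf h(1)]
    by (simp flip: h(2) add: map_prod_def)
  ultimately have "H = image_graph (iso_verts h) G" by (simp add: image_graph_def)
  moreover have "inj_on (iso_verts h) (pverts G)"
    using pre_digraph.digraph_isomorphism_inj_on_verts[OF h(1)] by simp
  ultimately show ?thesis using that by blast
qed

lemma digraph_iso_image_graph:
  assumes "pair_wf_digraph G" "inj_on f (pverts G)"
  shows "digraph_iso (with_proj G) (with_proj (image_graph f G))"
proof -
  interpret G: pair_wf_digraph G by fact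
  let ?h = "\<lparr>iso_verts = f, iso_arcs = map_prod f f, iso_head = snd, iso_tail = fst\<rparr>"
  have "parcs G \<subseteq> pverts G \<times> pverts G" using G.in_arcsD1 G.in_arcsD2 by auto
  then have "inj_on (map_prod f f) (parcs G)"
    by (rule inj_on_subset[OF map_prod_inj_on[OF assms(2) assms(2)]])
  then have "pre_digraph.digraph_isomorphism (with_proj G) ?h"
    using assms(2) G.wf_digraph by (auto simp: pre_digraph.digraph_isomorphism_def)
  moreover have "with_proj (image_graph f G) = app_iso ?h (with_proj G)"
    by (simp add: with_proj_def image_graph_def app_iso_def)
  ultimately show ?thesis unfolding digraph_iso_def by blast
qed

lemma (in multipartite_graph) complete_multipartite_image:
  assumes "inj_on f (pverts G)"
  shows "complete_multipartite_with (image_graph f G) ((`) f ` P)"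
proof -
  let ?H = "image_graph f G"
  have adj: "(f x, f y) \<in> parcs ?H \<longleftrightarrow> (x, y) \<in> parcs G" if "x \<in> pverts G" "y \<in> pverts G" for x y
  proof
    assume "(f x, f y) \<in> parcs ?H"
    then obtain x' y' where xy': "(x', y') \<in> parcs G" "f x = f x'" "f y = f y'"
      by (auto simp: image_graph_def)
    then have "x = x'" "y = y'"
      using that in_arcsD1[OF xy'(1)] in_arcsD2[OF xy'(1)] by (auto intro: inj_onD[OF assms])
    with xy'(1) show "(x, y) \<in> parcs G" by simp
  qed (force simp: image_graph_def)
  have graph: "pair_graph ?H"
  proof unfold_locales
    fix e assume "e \<in> parcs ?H"
    then obtain x y where xy: "(x, y) \<in> parcs G" "e = (f x, f y)" by (auto simp: image_graph_def)
    have V: "x \<in> pverts G" "y \<in> pverts G" using xy(1) in_arcsD1 in_arcsD2 by blast+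
    with xy(2) show "fst e \<in> pverts ?H" "snd e \<in> pverts ?H" by (simp_all add: image_graph_def)
    have "x \<noteq> y" using pair_no_loops[OF xy(1)] by simp
    with V xy(2) show "fst e \<noteq> snd e" using inj_onD[OF assms] by auto
  next
    show "symmetric (with_proj ?H)"
      using arcs_symmetric by (force simp: symmetric_def image_graph_def intro!: symI)
  qed (simp_all add: image_graph_def pair_finite_verts pair_finite_arcs)
  have "{} \<notin> (`) f ` P" using part_nonempty by auto
  then have partition: "partition_on (pverts ?H) ((`) f ` P)"
    using partition_on_inj_image[OF part assms] by (simp add: image_graph_def)
  have "(f x, f y) \<in> parcs ?H \<longleftrightarrow>
      (\<exists>A' \<in> (`) f ` P. \<exists>B' \<in> (`) f ` P. A' \<noteq> B' \<and> f x \<in> A' \<and> f y \<in> B')"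
    if "x \<in> pverts G" "y \<in> pverts G" for x y
  proof -
    have mem: "f z \<in> f ` A \<longleftrightarrow> z \<in> A" if "A \<in> P" "z \<in> pverts G" for A z
      using that assms part_subset by (meson inj_on_image_mem_iff)
    have neq: "f ` A \<noteq> f ` B \<longleftrightarrow> A \<noteq> B" if "A \<in> P" "B \<in> P" for A B
      using that assms part_subset by (metis inj_on_image_eq_iff)
    obtain A B where AB: "A \<in> P" "x \<in> A" "B \<in> P" "y \<in> B" using in_part \<open>x \<in> _\<close> \<open>y \<in> _\<close> by blast
    then have "(f x, f y) \<in> parcs ?H \<longleftrightarrow> A \<noteq> B" using adj that adjacent_iff by simp
    also have "\<dots> \<longleftrightarrow> (\<exists>A' \<in> P. \<exists>B' \<in> P. A' \<noteq> B' \<and> x \<in> A' \<and> y \<in> B')"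
      using AB part_unique[OF _ AB(1) _ AB(2)] part_unique[OF _ AB(3) _ AB(4)] by blast
    also have "\<dots> \<longleftrightarrow> (\<exists>A' \<in> P. \<exists>B' \<in> P. f ` A' \<noteq> f ` B' \<and> f x \<in> f ` A' \<and> f y \<in> f ` B')"
      by (intro bex_cong refl) (simp only: mem neq that)
    also have "\<dots> \<longleftrightarrow> (\<exists>A' \<in> (`) f ` P. \<exists>B' \<in> (`) f ` P. A' \<noteq> B' \<and> f x \<in> A' \<and> f y \<in> B')"
      by (simp only: bex_simps)
    finally show ?thesis .
  qed
  then have adjacency: "\<forall>u \<in> pverts ?H. \<forall>v \<in> pverts ?H. (u, v) \<in> parcs ?H \<longleftrightarrow>
      (\<exists>A' \<in> (`) f ` P. \<exists>B' \<in> (`) f ` P. A' \<noteq> B' \<and> u \<in> A' \<and> v \<in> B')"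
    by (simp add: image_graph_def)
  show ?thesis unfolding complete_multipartite_with_def
    by (intro conjI graph partition ballI impI) (rule adjacency[rule_format])
qed

lemma tough_parts_iso:
  assumes iso: "digraph_iso (with_proj G) (with_proj H)"
    and P: "complete_multipartite_with G P" "tough_parts l P"
  shows "\<exists>Q. complete_multipartite_with H Q \<and> tough_parts l Q"
proof -
  interpret G: multipartite_graph G P using P(1) by unfold_locales
  obtain f where f: "inj_on f (pverts G)" "H = image_graph f G"
    using iso by (rule digraph_iso_imp_image_graph)
  have "complete_multipartite_with H ((`) f ` P)"
    using G.complete_multipartite_image f by simp
  moreover have "tough_parts l ((`) f ` P)"
    using tough_parts_image[OF P(2)] f(1) partition_onD1[OF G.part] by simp
  ultimately show ?thesis by blast
qed

theorem theorem1p2: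
  fixes G :: "'a pair_pre_digraph"
  assumes "complete_multipartite G"
  shows "nontrivially_minimally_tough G \<longleftrightarrow>
    (\<exists>l::nat. l \<ge> 2 \<and> (\<exists>H :: nat pair_pre_digraph.
      digraph_iso (with_proj G) (with_proj H) \<and>
      (complete_bipartite_digraph 2 3 (with_proj H) \<or>
       complete_bipartite_digraph 1 l (with_proj H) \<or>
       turan (2 * l) l H \<or>
       turan (2 * l - 1) l H)))"
proof -
  obtain P where P: "complete_multipartite_with G P"
    using assms by (auto simp: complete_multipartite_def)
  then interpret G: multipartite_graph G P by unfold_locales
  have listed: "(\<exists>H :: nat pair_pre_digraph. digraph_iso (with_proj G) (with_proj H) \<and>
      (complete_bipartite_digraph 2 3 (with_proj H) \<or> complete_bipartite_digraph 1 l (with_proj H) \<or>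
       turan (2 * l) l H \<or> turan (2 * l - 1) l H)) \<longleftrightarrow>
    (\<exists>Q. complete_multipartite_with G Q \<and> tough_parts l Q)" (is "?L \<longleftrightarrow> ?R") if l: "l \<ge> 2" for l
  proof
    assume ?L
    then obtain H :: "nat pair_pre_digraph" and Q
      where iso: "digraph_iso (with_proj G) (with_proj H)"
        and Q: "complete_multipartite_with H Q" "tough_parts l Q"
      unfolding listed_graphs_iff_parts[OF l] by blast
    have "digraph_iso (with_proj H) (with_proj G)"
      using G.wf_digraph iso by (rule digraph_iso_swap)
    then show ?R using Q by (rule tough_parts_iso)
  next
    assume ?R
    then obtain Q where Q: "complete_multipartite_with G Q" "tough_parts l Q" by blast
    \<comment> \<open>The vertex set is finite, so the graph has an isomorphic copy on natural numbers.\<close>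
    obtain f :: "'a \<Rightarrow> nat" where f: "inj_on f (pverts G)"
      using finite_imp_inj_to_nat_seg[OF G.pair_finite_verts] by blast
    let ?H = "image_graph f G"
    have iso: "digraph_iso (with_proj G) (with_proj ?H)"
      using G.pair_wf_digraph_axioms f by (rule digraph_iso_image_graph)
    then have "\<exists>Q. complete_multipartite_with ?H Q \<and> tough_parts l Q"
      using Q by (rule tough_parts_iso)
    then show ?L using iso unfolding listed_graphs_iff_parts[OF l] by blast
  qed
  have tough: "nontrivially_minimally_tough G \<longleftrightarrow> (\<exists>l \<ge> 2. tough_parts l Q)"
    if "complete_multipartite_with G Q" for Q
    using that by (intro multipartite_graph.nontrivially_minimally_tough_iff_parts
        multipartite_graph.intro)
  show ?thesis
  proof
    assume "nontrivially_minimally_tough G"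
    then obtain l where l: "l \<ge> 2" "tough_parts l P" unfolding tough[OF P] by blast
    have ex: "\<exists>Q. complete_multipartite_with G Q \<and> tough_parts l Q" using P l(2) by blast
    show "\<exists>l \<ge> 2. \<exists>H :: nat pair_pre_digraph. digraph_iso (with_proj G) (with_proj H) \<and>
        (complete_bipartite_digraph 2 3 (with_proj H) \<or> complete_bipartite_digraph 1 l (with_proj H) \<or>
         turan (2 * l) l H \<or> turan (2 * l - 1) l H)"
      by (intro exI[of _ l] conjI l(1) iffD2[OF listed[OF l(1)] ex])
  next
    assume "\<exists>l \<ge> 2. \<exists>H :: nat pair_pre_digraph. digraph_iso (with_proj G) (with_proj H) \<and>
        (complete_bipartite_digraph 2 3 (with_proj H) \<or> complete_bipartite_digraph 1 l (with_proj H) \<or>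
         turan (2 * l) l H \<or> turan (2 * l - 1) l H)"
    then obtain l Q where "l \<ge> 2" "complete_multipartite_with G Q" "tough_parts l Q"
      using listed by (elim exE conjE) blast
    then show "nontrivially_minimally_tough G" using tough by blast
  qed
qed

end
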